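(* There exists a Butler group of countably infinite rank which is Bassian-finite but not completely decomposable.
   Context: All groups are abelian, written additively. A group is completely decomposable if it is a direct sum of torsion-free groups of rank $1$. A group $G$ is Bassian-finite if there is no monomorphism from $G$ to any proper direct summand of $G$ (a direct summand different from $G$). A torsion-free group of finite rank is a Butler group if it is a pure subgroup of a completely decomposable group of finite rank (equivalently, it is an epimorphic image of a completely decomposable group of finite rank). A torsion-free group $G$ of countably infinite rank is called a Butler group if it is a $B_2$-group; for countable rank this means that $G$ is the union of an ascending chain $0=G_0\leq G_1\leq G_2\leq\cdots$ of pure subgroups such that for each $n<\omega$, $G_{n+1}=G_n+B_n$ for some Butler group $B_n$ of finite rank (equivalently, $G$ is the union of an ascending chain of pure subgroups of finite rank each of which is a Butler group). *)

theory Defs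
  imports Complex_Main "HOL-Algebra.Free_Abelian_Groups"
begin

text \<open>
  Abelian groups are the \<^const>\<open>comm_group\<close>s of HOL-Algebra, hence written multiplicatively;
  the subgroup \<open>H\<close> of \<open>G\<close>, regarded as a group, is \<open>G\<lparr>carrier := H\<rparr>\<close>.
\<close>

definition torsion_free_group :: "('a, 'b) monoid_scheme \<Rightarrow> bool" where
  "torsion_free_group G \<longleftrightarrow> comm_group G \<and>
     (\<forall>x \<in> carrier G. \<forall>n::nat. n > 0 \<longrightarrow> x [^]\<^bsub>G\<^esub> n = \<one>\<^bsub>G\<^esub> \<longrightarrow> x = \<one>\<^bsub>G\<^esub>)"

definition Z_independent :: "('a, 'b) monoid_scheme \<Rightarrow> 'a set \<Rightarrow> bool" where
  "Z_independent G X \<longleftrightarrow> X \<subseteq> carrier G \<and>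
     (\<forall>F c. finite F \<longrightarrow> F \<subseteq> X \<longrightarrow>
        finprod G (\<lambda>x. x [^]\<^bsub>G\<^esub> (c x :: int)) F = \<one>\<^bsub>G\<^esub> \<longrightarrow> (\<forall>x \<in> F. c x = 0))"

definition max_Z_independent :: "('a, 'b) monoid_scheme \<Rightarrow> 'a set \<Rightarrow> bool" where
  "max_Z_independent G X \<longleftrightarrow> Z_independent G X \<and>
     (\<forall>Y. Z_independent G Y \<longrightarrow> X \<subseteq> Y \<longrightarrow> Y = X)"

text \<open>
  The rank of a torsion-free group is the cardinality of a maximal independent subset. All such
  subsets are equipotent, so it does not matter which one is inspected.
\<close>

definition finite_rank :: "('a, 'b) monoid_scheme \<Rightarrow> bool" where
  "finite_rank G \<longleftrightarrow> (\<exists>X. max_Z_independent G X \<and> finite X)"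

definition rank_one :: "('a, 'b) monoid_scheme \<Rightarrow> bool" where
  "rank_one G \<longleftrightarrow> (\<exists>X. max_Z_independent G X \<and> card X = 1)"

definition countably_infinite_rank :: "('a, 'b) monoid_scheme \<Rightarrow> bool" where
  "countably_infinite_rank G \<longleftrightarrow> (\<exists>X. max_Z_independent G X \<and> countable X \<and> infinite X)"

definition pure_subgroup :: "'a set \<Rightarrow> ('a, 'b) monoid_scheme \<Rightarrow> bool" where
  "pure_subgroup H G \<longleftrightarrow> subgroup H G \<and>
     (\<forall>n::nat. \<forall>g \<in> carrier G. n > 0 \<longrightarrow> g [^]\<^bsub>G\<^esub> n \<in> H \<longrightarrow>
        (\<exists>h \<in> H. h [^]\<^bsub>G\<^esub> n = g [^]\<^bsub>G\<^esub> n))"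

definition direct_summand :: "'a set \<Rightarrow> ('a, 'b) monoid_scheme \<Rightarrow> bool" where
  "direct_summand H G \<longleftrightarrow> subgroup H G \<and>
     (\<exists>K. subgroup K G \<and> H \<inter> K = {\<one>\<^bsub>G\<^esub>} \<and> H <#>\<^bsub>G\<^esub> K = carrier G)"

definition Bassian_finite :: "('a, 'b) monoid_scheme \<Rightarrow> bool" where
  "Bassian_finite G \<longleftrightarrow> comm_group G \<and>
     (\<forall>H. direct_summand H G \<longrightarrow> H \<noteq> carrier G \<longrightarrow> mon G (G\<lparr>carrier := H\<rparr>) = {})"

text \<open>
  The canonical map from the external direct sum of a family of subgroups to the group is an
  isomorphism. Indexing the family by the subgroups themselves loses nothing below, where all
  members are nontrivial and so can occur only once in a direct decomposition.
\<close>

definition internal_direct_sum :: "('a, 'b) monoid_scheme \<Rightarrow> 'a set set \<Rightarrow> bool" where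
  "internal_direct_sum G S \<longleftrightarrow> (\<forall>H \<in> S. subgroup H G) \<and>
     (\<lambda>x. gfinprod G x S) \<in> iso (sum_group S (\<lambda>H. G\<lparr>carrier := H\<rparr>)) G"

definition completely_decomposable :: "('a, 'b) monoid_scheme \<Rightarrow> bool" where
  "completely_decomposable G \<longleftrightarrow> comm_group G \<and>
     (\<exists>S. internal_direct_sum G S \<and>
        (\<forall>H \<in> S. torsion_free_group (G\<lparr>carrier := H\<rparr>) \<and> rank_one (G\<lparr>carrier := H\<rparr>)))"

text \<open>
  The ambient completely decomposable group has to live in a fixed type. A torsion-free group of
  finite rank embeds in some \<open>\<rat>\<^sup>n\<close>, so it has an isomorphic copy in \<^typ>\<open>nat \<Rightarrow> rat\<close>. (The
  operation of \<open>C\<close> is arbitrary; it need not be pointwise addition.)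
\<close>

definition finite_rank_Butler :: "('a, 'b) monoid_scheme \<Rightarrow> bool" where
  "finite_rank_Butler G \<longleftrightarrow> torsion_free_group G \<and> finite_rank G \<and>
     (\<exists>(C :: (nat \<Rightarrow> rat) monoid) f. completely_decomposable C \<and> finite_rank C \<and>
        f \<in> mon G C \<and> pure_subgroup (f ` carrier G) C)"

definition countable_rank_Butler :: "('a, 'b) monoid_scheme \<Rightarrow> bool" where
  "countable_rank_Butler G \<longleftrightarrow> torsion_free_group G \<and> countably_infinite_rank G \<and>
     (\<exists>A :: nat \<Rightarrow> 'a set. A 0 = {\<one>\<^bsub>G\<^esub>} \<and> (\<Union>n. A n) = carrier G \<and>
        (\<forall>n. pure_subgroup (A n) G \<and> A n \<subseteq> A (Suc n) \<and>
           (\<exists>B. subgroup B G \<and> finite_rank_Butler (G\<lparr>carrier := B\<rparr>) \<and>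
              A (Suc n) = A n <#>\<^bsub>G\<^esub> B)))"

end

theory Submission
  imports Defs "HOL-Library.Function_Algebras" "HOL-Computational_Algebra.Primes"
begin

text \<open>
  Attach a prime \<open>p\<^sub>i\<^sub>j\<close> to every edge of the complete graph on \<open>\<nat>\<close>, let \<open>A\<^sub>i \<le> \<rat>\<close> be the
  localization of \<open>\<int>\<close> inverting the primes of the edges at \<open>i\<close>, and let \<open>G\<close> be the
  kernel of the summation map \<open>\<Oplus>A\<^sub>i \<rightarrow> \<rat>\<close>. The elements of \<open>G\<close> supported in \<open>{..<n}\<close> form a pure
  subgroup of \<open>A\<^sub>0 \<oplus> \<dots> \<oplus> A\<^sub>n\<^sub>-\<^sub>1\<close>, so \<open>G\<close> is a Butler group. The elements of \<open>G\<close> that are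
  divisible by all powers of \<open>p\<^sub>i\<^sub>j\<close> have rank one and contain \<open>e\<^sub>j - e\<^sub>i\<close>; hence, whenever
  \<open>G = H \<oplus> K\<close>, each \<open>e\<^sub>j - e\<^sub>i\<close> lies in \<open>H\<close> or in \<open>K\<close>. Any two edges of a triangle generate the
  third, which forces all edges into the same summand. So \<open>G\<close> is indecomposable of infinite rank,
  which makes it Bassian-finite and not completely decomposable.
\<close>

section \<open>Groups of rational sequences\<close>

text \<open>Pointwise addition is put into the multiplicative records of the statement. All groups
  below live in one sequence space, so passing to a subgroup only changes the argument
  \<open>H\<close>.\<close>

definition fgroup :: "(nat \<Rightarrow> rat) set \<Rightarrow> (nat \<Rightarrow> rat) monoid" where
  "fgroup H = \<lparr>carrier = H, monoid.mult = (+), one = 0\<rparr>"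

definition add_subgroup :: "(nat \<Rightarrow> rat) set \<Rightarrow> bool" where
  "add_subgroup H \<longleftrightarrow> 0 \<in> H \<and> (\<forall>x \<in> H. \<forall>y \<in> H. x - y \<in> H)"

lemma fgroup_simps [simp]:
  "carrier (fgroup H) = H" "x \<otimes>\<^bsub>fgroup H\<^esub> y = x + y" "\<one>\<^bsub>fgroup H\<^esub> = 0"
  "fgroup H\<lparr>carrier := K\<rparr> = fgroup K"
  by (simp_all add: fgroup_def)

lemma add_subgroup_zero: "add_subgroup H \<Longrightarrow> 0 \<in> H"
  and add_subgroup_diff: "add_subgroup H \<Longrightarrow> x \<in> H \<Longrightarrow> y \<in> H \<Longrightarrow> x - y \<in> H"
  by (auto simp: add_subgroup_def)

lemma add_subgroup_uminus: "add_subgroup H \<Longrightarrow> x \<in> H \<Longrightarrow> - x \<in> H"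
  by (metis add_subgroup_zero add_subgroup_diff diff_0)

lemma add_subgroup_add: "add_subgroup H \<Longrightarrow> x \<in> H \<Longrightarrow> y \<in> H \<Longrightarrow> x + y \<in> H"
  by (metis add_subgroup_uminus add_subgroup_diff diff_minus_eq_add)

lemma add_subgroup_sum:
  "add_subgroup H \<Longrightarrow> (\<And>a. a \<in> F \<Longrightarrow> f a \<in> H) \<Longrightarrow> sum f F \<in> H"
  by (induction F rule: infinite_finite_induct) (auto intro: add_subgroup_zero add_subgroup_add)

lemma sum_fun_apply: "sum f F i = (\<Sum>a\<in>F. f a i)"
  for f :: "'b \<Rightarrow> 'c \<Rightarrow> 'd::comm_monoid_add"
  by (induction F rule: infinite_finite_induct) auto

lemma comm_group_fgroup:
  assumes "add_subgroup H" shows "comm_group (fgroup H)"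
proof (rule comm_groupI)
  fix x assume "x \<in> carrier (fgroup H)"
  then show "\<exists>y\<in>carrier (fgroup H). y \<otimes>\<^bsub>fgroup H\<^esub> x = \<one>\<^bsub>fgroup H\<^esub>"
    using assms by (intro bexI[of _ "- x"]) (auto intro: add_subgroup_uminus)
qed (use assms in \<open>auto simp: add.assoc add.commute intro: add_subgroup_zero add_subgroup_add\<close>)

lemma inv_fgroup:
  assumes "add_subgroup H" "x \<in> H" shows "inv\<^bsub>fgroup H\<^esub> x = - x"
proof -
  interpret comm_group "fgroup H" by (rule comm_group_fgroup) fact
  show ?thesis using assms by (intro inv_equality) (auto intro: add_subgroup_uminus)
qed

lemma nat_pow_fgroup: "x [^]\<^bsub>fgroup H\<^esub> (n::nat) = (\<lambda>i. of_nat n * x i)"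
  by (induction n) (auto simp: nat_pow_def fun_eq_iff algebra_simps)

lemma int_pow_fgroup:
  assumes "add_subgroup H" "x \<in> H" shows "x [^]\<^bsub>fgroup H\<^esub> (k::int) = (\<lambda>i. of_int k * x i)"
proof -
  interpret comm_group "fgroup H" by (rule comm_group_fgroup) fact
  have "x [^]\<^bsub>fgroup H\<^esub> n \<in> H" for n :: nat
    using nat_pow_closed[of x n] assms by simp
  then have inv: "inv\<^bsub>fgroup H\<^esub> (x [^]\<^bsub>fgroup H\<^esub> n) = - (\<lambda>i. of_nat n * x i)" for n :: nat
    using assms(1) by (simp add: inv_fgroup nat_pow_fgroup)
  show ?thesis
  proof (cases "k < 0")
    case True
    then show ?thesis by (simp only: int_pow_def2 inv) (simp add: fun_eq_iff)
  next
    case False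
    then show ?thesis by (simp add: int_pow_def2 nat_pow_fgroup)
  qed
qed

lemma add_subgroup_int_mult:
  assumes "add_subgroup H" "x \<in> H" shows "(\<lambda>i. of_int k * x i) \<in> H"
proof -
  interpret comm_group "fgroup H" by (rule comm_group_fgroup) fact
  show ?thesis using int_pow_closed[of x k] assms by (simp add: int_pow_fgroup)
qed

lemma subgroup_fgroup_iff:
  assumes "add_subgroup H"
  shows "subgroup K (fgroup H) \<longleftrightarrow> add_subgroup K \<and> K \<subseteq> H"
proof
  assume K: "subgroup K (fgroup H)"
  have "x - y \<in> K" if "x \<in> K" "y \<in> K" for x y
    using subgroup.m_closed[OF K that(1) subgroup.m_inv_closed[OF K that(2)]]
      subgroup.mem_carrier[OF K that(2)] assms
    by (simp add: inv_fgroup)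
  then show "add_subgroup K \<and> K \<subseteq> H"
    using subgroup.one_closed[OF K] subgroup.subset[OF K] by (auto simp: add_subgroup_def)
next
  assume K: "add_subgroup K \<and> K \<subseteq> H"
  interpret comm_group "fgroup H" by (rule comm_group_fgroup) fact
  show "subgroup K (fgroup H)"
    using K assms by (intro subgroupI)
      (auto simp: inv_fgroup subset_iff intro: add_subgroup_zero add_subgroup_add add_subgroup_uminus)
qed

lemma finprod_fgroup:
  assumes "add_subgroup H" "f ` F \<subseteq> H"
  shows "finprod (fgroup H) f F = sum f F"
proof -
  interpret comm_group "fgroup H" by (rule comm_group_fgroup) fact
  show ?thesis using assms(2)
    by (induction F rule: infinite_finite_induct) (auto simp: Pi_def image_subset_iff)
qed

lemma torsion_free_fgroup:
  assumes "add_subgroup H" shows "torsion_free_group (fgroup H)"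
  using comm_group_fgroup[OF assms]
  by (auto simp: torsion_free_group_def nat_pow_fgroup fun_eq_iff)

section \<open>Integral independence and rank\<close>

lemma Z_independent_fgroup_iff:
  assumes "add_subgroup H"
  shows "Z_independent (fgroup H) X \<longleftrightarrow> X \<subseteq> H \<and>
    (\<forall>F c. finite F \<longrightarrow> F \<subseteq> X \<longrightarrow> (\<forall>i. (\<Sum>x\<in>F. of_int (c x) * x i) = 0) \<longrightarrow> (\<forall>x\<in>F. c x = 0))"
proof (cases "X \<subseteq> H")
  case True
  have *: "finprod (fgroup H) (\<lambda>x. x [^]\<^bsub>fgroup H\<^esub> (c x :: int)) F = 0 \<longleftrightarrow>
      (\<forall>i. (\<Sum>x\<in>F. of_int (c x) * x i) = 0)"
    if "F \<subseteq> X" for F and c :: "(nat \<Rightarrow> rat) \<Rightarrow> int"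
  proof -
    interpret comm_group "fgroup H" by (rule comm_group_fgroup) fact
    have F: "x [^]\<^bsub>fgroup H\<^esub> c x = (\<lambda>i. of_int (c x) * x i)" "(\<lambda>i. of_int (c x) * x i) \<in> H"
      if "x \<in> F" for x
      using that \<open>F \<subseteq> X\<close> True assms by (auto simp: int_pow_fgroup intro: add_subgroup_int_mult)
    have "finprod (fgroup H) (\<lambda>x. x [^]\<^bsub>fgroup H\<^esub> c x) F = (\<Sum>x\<in>F. x [^]\<^bsub>fgroup H\<^esub> c x)"
      using F by (intro finprod_fgroup assms) auto
    also have "\<dots> = (\<Sum>x\<in>F. (\<lambda>i. of_int (c x) * x i))"
      using F by (intro sum.cong) auto
    finally show ?thesis by (simp add: fun_eq_iff sum_fun_apply)
  qed
  with True show ?thesis by (simp add: Z_independent_def)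
qed (simp add: Z_independent_def)

lemma common_denominator:
  fixes g :: "'b \<Rightarrow> rat"
  assumes "finite F"
  shows "\<exists>m::int. m > 0 \<and> (\<forall>i\<in>F. of_int m * g i \<in> \<int>)"
  using assms
proof induction
  case (insert a F)
  then obtain m where m: "m > 0" "\<forall>i\<in>F. of_int m * g i \<in> \<int>" by blast
  obtain u v where uv: "quotient_of (g a) = (u, v)" by fastforce
  then have v: "v > 0" "g a = of_int u / of_int v"
    by (simp_all add: quotient_of_denom_pos quotient_of_div)
  have "of_int (m * v) * g i \<in> \<int>" if "i \<in> insert a F" for i
  proof (cases "i = a")
    case True
    then have "of_int (m * v) * g i = of_int (m * u)" using v by simp
    then show ?thesis by (metis Ints_of_int)
  next
    case False
    then have "of_int v * (of_int m * g i) \<in> \<int>" using that m by auto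
    then show ?thesis by (simp add: ac_simps)
  qed
  with m v show ?case by (intro exI[of _ "m * v"]) auto
qed (auto intro: exI[of _ 1])

text \<open>The coordinates in \<open>I\<close> act as functionals dual to the vectors
  \<open>b i\<close>. One computation of maximal independent sets in this setting serves the stages,
  the boxes, the axes and the whole edge group.\<close>

locale dual_basis =
  fixes H :: "(nat \<Rightarrow> rat) set" and I :: "nat set" and b :: "nat \<Rightarrow> nat \<Rightarrow> rat"
  assumes add_subgroup: "add_subgroup H"
    and basis_mem: "i \<in> I \<Longrightarrow> b i \<in> H"
    and dual: "i \<in> I \<Longrightarrow> j \<in> I \<Longrightarrow> b i j = of_bool (i = j)"
    and finite_support: "g \<in> H \<Longrightarrow> finite {i \<in> I. g i \<noteq> 0}"
    and separating: "g \<in> H \<Longrightarrow> (\<And>i. i \<in> I \<Longrightarrow> g i = 0) \<Longrightarrow> g = 0"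
begin

lemma inj_on_basis: "inj_on b I"
proof (rule inj_onI)
  fix i j assume ij: "i \<in> I" "j \<in> I" "b i = b j"
  show "i = j" using dual[of i j] dual[of j j] ij by (simp split: if_splits)
qed

text \<open>Clear the denominators of the finitely many nonzero coordinates of \<open>g\<close> in
  \<open>I\<close> and use the resulting integers as coefficients. The difference of both sides
  vanishes on \<open>I\<close>, so it is zero by \<open>separating\<close>.\<close>

lemma multiple_in_span:
  assumes "g \<in> H"
  obtains m :: int and F and c :: "nat \<Rightarrow> int" where "m > 0" "finite F" "F \<subseteq> I"
    "(\<lambda>i. of_int m * g i) = (\<Sum>k\<in>F. (\<lambda>i. of_int (c k) * b k i))"
proof -
  let ?F = "{i \<in> I. g i \<noteq> 0}"
  have F: "finite ?F" using assms by (rule finite_support)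
  obtain m :: int where m: "m > 0" "\<forall>i\<in>?F. of_int m * g i \<in> \<int>"
    using common_denominator[OF F] by blast
  define c where "c i = \<lfloor>of_int m * g i\<rfloor>" for i
  have c: "of_int (c i) = of_int m * g i" if "i \<in> ?F" for i
    using m that by (auto simp: c_def elim!: Ints_cases)
  define s where "s = (\<Sum>k\<in>?F. (\<lambda>i. of_int (c k) * b k i))"
  define h where "h = (\<lambda>i. of_int m * g i) - s"
  have "h \<in> H"
    unfolding h_def s_def using assms add_subgroup basis_mem
    by (intro add_subgroup_diff add_subgroup_sum add_subgroup_int_mult) auto
  moreover have "h i = 0" if i: "i \<in> I" for i
  proof -
    have "s i = (\<Sum>k\<in>?F. of_int (c k) * of_bool (k = i))"
      using i by (auto simp: s_def sum_fun_apply dual intro!: sum.cong)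
    also have "\<dots> = (\<Sum>k\<in>?F. if k = i then of_int m * g i else 0)"
      using c by (intro sum.cong) auto
    also have "\<dots> = of_int m * g i" using F i by auto
    finally show ?thesis by (simp add: h_def)
  qed
  ultimately have "h = 0" by (rule separating)
  then show ?thesis using that[OF m(1) F, of c] by (simp add: h_def s_def)
qed

text \<open>Evaluating a relation at coordinate \<open>j\<close> isolates the coefficient of
  \<open>b j\<close>, which gives independence. Nothing can be added, since every further element
  has a positive multiple in the integral span.\<close>

lemma max_Z_independent: "max_Z_independent (fgroup H) (b ` I)"
  unfolding max_Z_independent_def
proof (intro conjI allI impI)
  have "c x = 0" if F: "finite F" "F \<subseteq> b ` I" "x \<in> F"
    and 0: "\<forall>i. (\<Sum>x\<in>F. of_int (c x) * x i) = 0" for F x and c :: "_ \<Rightarrow> int"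
  proof -
    obtain j where j: "j \<in> I" "x = b j" using F by auto
    have "(\<Sum>y\<in>F. of_int (c y) * y j) = (\<Sum>y\<in>F. if y = x then of_int (c x) else 0)"
      using F j by (intro sum.cong) (auto simp: dual subset_iff image_iff)
    then show ?thesis using 0 F by simp
  qed
  then show "Z_independent (fgroup H) (b ` I)"
    using basis_mem by (auto simp: Z_independent_fgroup_iff[OF add_subgroup])
  fix Y assume Y: "Z_independent (fgroup H) Y" "b ` I \<subseteq> Y"
  have "y \<in> b ` I" if "y \<in> Y" for y
  proof (rule ccontr)
    assume y: "y \<notin> b ` I"
    have "y \<in> H" using Y that by (auto simp: Z_independent_fgroup_iff[OF add_subgroup])
    then obtain m :: int and F and c :: "nat \<Rightarrow> int" where m: "m > 0" "finite F" "F \<subseteq> I"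
      "(\<lambda>i. of_int m * y i) = (\<Sum>k\<in>F. (\<lambda>i. of_int (c k) * b k i))"
      by (rule multiple_in_span)
    \<comment> \<open>These are the coefficients of the relation
      \<open>m * y - (\<Sum>k\<in>F. c k * b k) = 0\<close>. Relations are indexed by vectors, so
      \<open>c\<close> is transported along the inverse of \<open>b\<close>.\<close>
    define d where "d x = (if x = y then m else - c (inv_into I b x))" for x
    have d: "d (b k) = - c k" if "k \<in> F" for k
      using that m(3) y inj_on_basis by (auto simp: d_def inv_into_f_f subset_iff)
    have "(\<Sum>x\<in>insert y (b ` F). of_int (d x) * x i) = 0" for i
    proof -
      have "(\<Sum>x\<in>b ` F. of_int (d x) * x i) = (\<Sum>k\<in>F. of_int (d (b k)) * b k i)"
        using m(3) inj_on_basis by (subst sum.reindex) (auto intro: inj_on_subset)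
      also have "\<dots> = (\<Sum>k\<in>F. - (of_int (c k) * b k i))"
        by (intro sum.cong) (auto simp: d)
      also have "\<dots> = - (of_int m * y i)"
        by (simp add: sum_negf fun_cong[OF m(4)] sum_fun_apply)
      finally show ?thesis
        using m y by (subst sum.insert) (auto simp: d_def)
    qed
    moreover have "finite (insert y (b ` F))" "insert y (b ` F) \<subseteq> Y"
      using Y m \<open>y \<in> Y\<close> by auto
    ultimately have "d y = 0"
      using Y(1)[unfolded Z_independent_fgroup_iff[OF add_subgroup], THEN conjunct2,
          rule_format, of "insert y (b ` F)" d y] by simp
    then show False using m by (simp add: d_def)
  qed
  with Y show "Y = b ` I" by blast
qed

end

section \<open>The group of edges\<close>

definition localized :: "nat set \<Rightarrow> rat set" where
  "localized P = {x. \<exists>d::nat. d > 0 \<and> (\<forall>p. prime p \<longrightarrow> p dvd d \<longrightarrow> p \<in> P) \<and> of_nat d * x \<in> \<int>}"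

lemma Ints_subset_localized: "x \<in> \<int> \<Longrightarrow> x \<in> localized P"
  by (auto simp: localized_def intro!: exI[of _ 1])

lemma localized_diff:
  assumes "x \<in> localized P" "y \<in> localized P" shows "x - y \<in> localized P"
proof -
  obtain d where d: "d > 0" "\<forall>p. prime p \<longrightarrow> p dvd d \<longrightarrow> p \<in> P" "of_nat d * x \<in> \<int>"
    using assms(1) by (auto simp: localized_def)
  obtain e where e: "e > 0" "\<forall>p. prime p \<longrightarrow> p dvd e \<longrightarrow> p \<in> P" "of_nat e * y \<in> \<int>"
    using assms(2) by (auto simp: localized_def)
  have "of_nat e * (of_nat d * x) - of_nat d * (of_nat e * y) \<in> \<int>"
    by (intro Ints_diff Ints_mult[OF Ints_of_nat] d e)
  then have "of_nat (d * e) * (x - y) \<in> \<int>"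
    by (simp add: algebra_simps)
  then show ?thesis
    using d e by (auto simp: localized_def prime_dvd_mult_iff intro!: exI[of _ "d * e"])
qed

lemma localized_divide_power:
  assumes "x \<in> localized P" "prime p" "p \<in> P"
  shows "x / of_nat p ^ k \<in> localized P"
proof -
  obtain d where d: "d > 0" "\<forall>p. prime p \<longrightarrow> p dvd d \<longrightarrow> p \<in> P" "of_nat d * x \<in> \<int>"
    using assms(1) by (auto simp: localized_def)
  have "p > 0" using assms by (simp add: prime_gt_0_nat)
  then have "of_nat (d * p ^ k) * (x / of_nat p ^ k) = of_nat d * x" by simp
  moreover have "q \<in> P" if "prime q" "q dvd d * p ^ k" for q
    using that d assms by (metis prime_dvd_mult_iff prime_dvd_power primes_dvd_imp_eq)
  ultimately show ?thesis
    using d \<open>p > 0\<close> by (auto simp: localized_def intro!: exI[of _ "d * p ^ k"])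
qed

text \<open>Write \<open>d * x = u\<close> with \<open>u\<close> an integer. Denominators in
  \<open>localized P\<close> are prime to \<open>p\<close>, so clearing them in
  \<open>x = p ^ k * y\<close> shows that \<open>p ^ k\<close> divides the fixed integer
  \<open>u\<close> for every \<open>k\<close>.\<close>

lemma localized_p_divisible_imp_zero:
  assumes p: "prime p" "p \<notin> P" and div: "\<And>k. \<exists>y \<in> localized P. x = of_nat p ^ k * y"
  shows "x = 0"
proof -
  have "x \<in> localized P" using div[of 0] by simp
  then obtain d u where d: "d > 0" "of_nat d * x = of_int u"
    by (auto simp: localized_def elim!: Ints_cases)
  have dvd: "int p ^ k dvd u" for k
  proof -
    obtain y where y: "y \<in> localized P" "x = of_nat p ^ k * y" using div by blast
    then obtain e v where e: "\<forall>p. prime p \<longrightarrow> p dvd e \<longrightarrow> p \<in> P" "of_nat e * y = of_int v"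
      by (auto simp: localized_def elim!: Ints_cases)
    have "of_int (int e * u) = of_nat e * (of_nat d * x)" by (simp add: d)
    also have "\<dots> = of_nat d * of_nat p ^ k * (of_nat e * y)" by (simp add: y)
    also have "\<dots> = of_int (int d * int p ^ k * v)" by (simp add: e)
    finally have "int e * u = int p ^ k * (int d * v)" by (simp only: of_int_eq_iff) simp
    then have "int p ^ k dvd int e * u" by simp
    moreover have "coprime (p ^ k) e"
      using e p by (intro coprime_power_left_iff[THEN iffD2]) (auto intro: prime_imp_coprime)
    then have "coprime (int p ^ k) (int e)" by (simp flip: of_nat_power)
    ultimately show ?thesis by (simp add: coprime_dvd_mult_right_iff)
  qed
  have "u = 0"
  proof (rule ccontr)
    assume "u \<noteq> 0"
    \<comment> \<open>The exponent \<open>\<bar>u\<bar>\<close> is large enough because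
      \<open>n < p ^ n\<close>.\<close>
    have "int p ^ nat \<bar>u\<bar> \<le> \<bar>u\<bar>" using dvd_imp_le_int[OF \<open>u \<noteq> 0\<close> dvd, of "nat \<bar>u\<bar>"] by simp
    moreover have "nat \<bar>u\<bar> < p ^ nat \<bar>u\<bar>"
      using p by (intro power_gt_expt) (auto simp: prime_ge_2_nat dest: prime_ge_2_nat)
    then have "\<bar>u\<bar> < int p ^ nat \<bar>u\<bar>" by (simp add: nat_less_iff)
    ultimately show False by simp
  qed
  with d show ?thesis by simp
qed

section \<open>Edge primes, stages and the edge group\<close>

definition edge_prime :: "nat \<Rightarrow> nat \<Rightarrow> nat" where
  "edge_prime i j = enumerate {p. prime p} (prod_encode (i, j))"

lemma prime_edge_prime: "prime (edge_prime i j)"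
  using enumerate_in_set[OF primes_infinite] by (simp add: edge_prime_def)

lemma edge_prime_eq_iff: "edge_prime i j = edge_prime k l \<longleftrightarrow> i = k \<and> j = l"
  using strict_mono_enumerate[OF primes_infinite] by (simp add: edge_prime_def strict_mono_eq)

text \<open>\<open>edge_prime\<close> is injective on ordered pairs, so the two orientations of an
  edge carry different primes; the primes of both orientations are inverted at each
  endpoint.\<close>

definition coord :: "nat \<Rightarrow> rat set" where
  "coord i = localized {p. \<exists>j. p = edge_prime i j \<or> p = edge_prime j i}"

lemma coord_Ints: "x \<in> \<int> \<Longrightarrow> x \<in> coord i"
  and coord_diff: "x \<in> coord i \<Longrightarrow> y \<in> coord i \<Longrightarrow> x - y \<in> coord i"
  by (simp_all add: coord_def Ints_subset_localized localized_diff)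

lemma coord_zero [simp]: "0 \<in> coord i" and coord_one [simp]: "1 \<in> coord i"
  by (simp_all add: coord_Ints)

text \<open>The direct sum of the first \<open>n\<close> coordinate groups, realized inside the
  sequence space. It is the completely decomposable group in which \<open>stage n\<close> is
  pure.\<close>

definition box :: "nat \<Rightarrow> (nat \<Rightarrow> rat) set" where
  "box n = {x. (\<forall>i. x i \<in> coord i) \<and> (\<forall>i\<ge>n. x i = 0)}"

definition axis :: "nat \<Rightarrow> (nat \<Rightarrow> rat) set" where
  "axis i = {x. x i \<in> coord i \<and> (\<forall>j. j \<noteq> i \<longrightarrow> x j = 0)}"

definition stage :: "nat \<Rightarrow> (nat \<Rightarrow> rat) set" where
  "stage n = {x \<in> box n. (\<Sum>i<n. x i) = 0}"

text \<open>Taking the union of the finite stages expresses the kernel of the summation map without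
  sums over infinite index sets, and provides the Butler chain directly.\<close>

definition edge_group :: "(nat \<Rightarrow> rat) set" where
  "edge_group = (\<Union>n. stage n)"

definition edge :: "nat \<Rightarrow> nat \<Rightarrow> nat \<Rightarrow> rat" where
  "edge i j l = of_bool (l = j) - of_bool (l = i)"

lemma edge_neq_zero: "i \<noteq> j \<Longrightarrow> edge i j \<noteq> 0"
proof
  assume "i \<noteq> j" "edge i j = 0"
  then have "edge i j j = 0" by simp
  with \<open>i \<noteq> j\<close> show False by (simp add: edge_def)
qed

lemma add_subgroup_box: "add_subgroup (box n)"
  and add_subgroup_axis: "add_subgroup (axis i)"
  by (auto simp: add_subgroup_def box_def axis_def coord_diff)

lemma add_subgroup_stage: "add_subgroup (stage n)"
  using add_subgroup_box[of n] by (auto simp: add_subgroup_def stage_def sum_subtractf)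

lemma sum_lessThan_support:
  fixes x :: "nat \<Rightarrow> rat"
  assumes "\<forall>i\<ge>n. x i = 0" "n \<le> m" shows "(\<Sum>i<m. x i) = (\<Sum>i<n. x i)"
  using assms by (intro sum.mono_neutral_right) auto

lemma stage_mono: "n \<le> m \<Longrightarrow> stage n \<subseteq> stage m"
  using sum_lessThan_support[of n _ m] by (fastforce simp: stage_def box_def)

text \<open>Membership in a longer stage suffices, as the extra summands are zero and the coordinate
  sum does not change.\<close>

lemma edge_group_support:
  assumes "x \<in> edge_group" "\<forall>i\<ge>n. x i = 0" shows "x \<in> stage n"
proof -
  obtain m where m: "x \<in> stage m" using assms(1) by (auto simp: edge_group_def)
  show ?thesis
  proof (cases "m \<le> n")
    case True
    then show ?thesis using m stage_mono by blast
  next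
    case False
    then show ?thesis using m assms(2) sum_lessThan_support[of n x m] by (auto simp: stage_def box_def)
  qed
qed

lemma stage_subset_edge_group: "stage n \<subseteq> edge_group"
  by (auto simp: edge_group_def)

lemma add_subgroup_edge_group: "add_subgroup edge_group"
  unfolding add_subgroup_def
proof (intro conjI ballI)
  show "0 \<in> edge_group"
    using add_subgroup_zero[OF add_subgroup_stage] stage_subset_edge_group by blast
  fix x y assume "x \<in> edge_group" "y \<in> edge_group"
  then obtain m n where "x \<in> stage m" "y \<in> stage n" by (auto simp: edge_group_def)
  then have "x \<in> stage (max m n)" "y \<in> stage (max m n)"
    using stage_mono[of m "max m n"] stage_mono[of n "max m n"] by auto
  then show "x - y \<in> edge_group"
    using add_subgroup_diff[OF add_subgroup_stage] stage_subset_edge_group by blast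
qed

text \<open>The edge can be nonzero only at its endpoints, and both endpoint groups invert its
  prime. Hence edges are divisible by all powers of their primes.\<close>

lemma edge_divide_in_stage:
  assumes "i < n" "j < n"
  shows "(\<lambda>l. edge i j l / of_nat (edge_prime i j) ^ k) \<in> stage n"
proof -
  let ?p = "edge_prime i j"
  have "edge i j l / of_nat ?p ^ k \<in> coord l" for l
  proof (cases "l = i \<or> l = j")
    case True
    then have "?p \<in> {p. \<exists>j. p = edge_prime l j \<or> p = edge_prime j l}" by auto
    moreover have "edge i j l \<in> coord l" by (intro coord_Ints) (auto simp: edge_def)
    ultimately show ?thesis
      using prime_edge_prime unfolding coord_def by (intro localized_divide_power)
  qed (simp add: edge_def)
  moreover have "(\<Sum>l<n. edge i j l) = 0"
    using assms by (simp add: edge_def sum_subtractf of_bool_def)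
  ultimately show ?thesis
    using assms by (auto simp: stage_def box_def edge_def simp flip: sum_divide_distrib)
qed

lemma edge_in_stage: "i < n \<Longrightarrow> j < n \<Longrightarrow> edge i j \<in> stage n"
  using edge_divide_in_stage[of i n j 0] by simp

lemma edge_divide_in_edge_group:
  "(\<lambda>l. edge i j l / of_nat (edge_prime i j) ^ k) \<in> edge_group"
  by (rule subsetD[OF stage_subset_edge_group edge_divide_in_stage[of i "Suc (max i j)" j]]) simp_all

lemma edge_in_edge_group: "edge i j \<in> edge_group"
  using edge_divide_in_edge_group[of i j 0] by simp

text \<open>The vanishing sum determines coordinate 0 from the others. This is why the index sets of
  the dual bases start at 1.\<close>

lemma stage_eq_zeroI:
  assumes "x \<in> stage n" "\<And>i. i \<in> {1..<n} \<Longrightarrow> x i = 0" shows "x = 0"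
proof -
  have x: "x i = 0" if "i \<noteq> 0" for i
    using assms that by (cases "i < n") (auto simp: stage_def box_def)
  have "(\<Sum>i<n. x i) = (\<Sum>i<n. if i = 0 then x 0 else 0)"
    by (intro sum.cong) (auto simp: x)
  then have "x 0 = 0"
    using assms(1) by (cases "n = 0") (auto simp: stage_def box_def)
  then have "x i = 0" for i using x by (cases "i = 0") auto
  then show ?thesis by (simp add: fun_eq_iff)
qed

text \<open>\<open>edge 0 i\<close> has entry 1 at \<open>i\<close> and entry -1 only at 0. With 0
  left out of the index set, the star of edges at 0 is dual to the coordinates.\<close>

lemma dual_basis_stage: "dual_basis (stage n) {1..<n} (edge 0)"
proof
  show "x = 0" if "x \<in> stage n" "\<And>i. i \<in> {1..<n} \<Longrightarrow> x i = 0" for x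
    using that by (rule stage_eq_zeroI)
qed (auto simp: add_subgroup_stage edge_in_stage, auto simp: edge_def)

lemma dual_basis_edge_group: "dual_basis edge_group {1..} (edge 0)"
proof
  show "finite {i \<in> {1..}. g i \<noteq> 0}" if g: "g \<in> edge_group" for g
  proof -
    obtain n where "g \<in> stage n" using g by (auto simp: edge_group_def)
    then have "{i \<in> {1..}. g i \<noteq> 0} \<subseteq> {..<n}"
      by (auto simp: stage_def box_def) (metis not_le_imp_less)
    then show ?thesis by (rule finite_subset) simp
  qed
  show "x = 0" if "x \<in> edge_group" "\<And>i. i \<in> {1..} \<Longrightarrow> x i = 0" for x
    using that by (auto simp: edge_group_def intro: stage_eq_zeroI)
qed (auto simp: add_subgroup_edge_group edge_in_edge_group, auto simp: edge_def)

lemma dual_basis_box: "dual_basis (box n) {..<n} (\<lambda>i l. of_bool (l = i))"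
proof
  show "x = 0" if "x \<in> box n" "\<And>i. i \<in> {..<n} \<Longrightarrow> x i = 0" for x
    using that by (auto simp: box_def fun_eq_iff) (metis not_le_imp_less)
qed (rule add_subgroup_box, auto simp: box_def)

lemma dual_basis_axis: "dual_basis (axis i) {i} (\<lambda>i l. of_bool (l = i))"
  by (standard, rule add_subgroup_axis) (auto simp: axis_def fun_eq_iff)

lemma finite_rank_stage: "finite_rank (fgroup (stage n))"
  and finite_rank_box: "finite_rank (fgroup (box n))"
  using dual_basis.max_Z_independent[OF dual_basis_stage]
    dual_basis.max_Z_independent[OF dual_basis_box]
  by (auto simp: finite_rank_def)

lemma rank_one_axis: "rank_one (fgroup (axis i))"
  using dual_basis.max_Z_independent[OF dual_basis_axis, of i]
  by (auto simp: rank_one_def intro!: exI)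

lemma countably_infinite_rank_edge_group: "countably_infinite_rank (fgroup edge_group)"
proof -
  interpret dual_basis edge_group "{1..}" "edge 0" by (rule dual_basis_edge_group)
  have "infinite (edge 0 ` {1..})"
    using inj_on_basis by (simp add: finite_image_iff infinite_Ici)
  then show ?thesis
    using max_Z_independent by (auto simp: countably_infinite_rank_def intro!: exI)
qed

section \<open>Complete decomposability of the boxes\<close>

lemma axis_eq_iff: "axis i = axis j \<longleftrightarrow> i = j"
proof
  assume "axis i = axis j"
  moreover have "(\<lambda>l. of_bool (l = i)) \<in> axis i" by (simp add: axis_def)
  ultimately show "i = j" by (auto simp: axis_def split: if_splits)
qed simp

text \<open>The summands are the axes. Since distinct indices give distinct axes, a family indexed
  by these subgroups amounts to a family indexed by \<open>{..<n}\<close>.\<close>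

lemma completely_decomposable_box: "completely_decomposable (fgroup (box n))"
proof -
  let ?S = "axis ` {..<n}" and ?B = "fgroup (box n)"
  let ?\<Phi> = "\<lambda>x. gfinprod ?B x ?S" and ?D = "sum_group ?S (\<lambda>H. ?B\<lparr>carrier := H\<rparr>)"
  interpret comm_group ?B by (rule comm_group_fgroup[OF add_subgroup_box])
  have sub: "H \<subseteq> box n" if "H \<in> ?S" for H
    using that by (auto simp: axis_def box_def) (metis coord_zero)+
  have "group (?B\<lparr>carrier := H\<rparr>)" if "H \<in> ?S" for H
    using that comm_group_fgroup[OF add_subgroup_axis] by (auto simp: comm_group_def)
  then have D: "carrier ?D = (\<Pi>\<^sub>E H\<in>?S. H)"
    by (subst carrier_sum_group) auto
  then have axis: "x (axis i) \<in> axis i" if "x \<in> carrier ?D" "i < n" for x i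
    using that by auto
  \<comment> \<open>Only the component in \<open>axis j\<close> contributes to coordinate
    \<open>j\<close>. This formula reduces the homomorphism property and bijectivity to
    coordinatewise checks.\<close>
  have \<Phi>: "?\<Phi> x j = (if j < n then x (axis j) j else 0)" if x: "x \<in> carrier ?D" for x j
  proof -
    have xB: "x ` ?S \<subseteq> box n" using x sub unfolding D by (fastforce simp: PiE_iff)
    then have "?\<Phi> x = finprod ?B x ?S" by (intro gfinprod_eq_finprod) auto
    also have "\<dots> = (\<Sum>H\<in>?S. x H)" by (rule finprod_fgroup[OF add_subgroup_box xB])
    also have "\<dots> = (\<Sum>i<n. x (axis i))"
      by (simp add: sum.reindex inj_on_def axis_eq_iff)
    finally have "?\<Phi> x j = (\<Sum>i<n. x (axis i) j)" by (simp add: sum_fun_apply)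
    also have "\<dots> = (\<Sum>i<n. if i = j then x (axis j) j else 0)"
      using axis[OF x] by (intro sum.cong) (auto simp: axis_def)
    finally show ?thesis by simp
  qed
  have "?\<Phi> \<in> iso ?D ?B"
    unfolding iso_def mem_Collect_eq
  proof (intro conjI homI)
    fix x assume x: "x \<in> carrier ?D"
    then show "?\<Phi> x \<in> carrier ?B" using \<Phi>[OF x] axis[OF x] by (auto simp: box_def axis_def)
    fix y assume y: "y \<in> carrier ?D"
    have "x \<otimes>\<^bsub>?D\<^esub> y \<in> carrier ?D"
      using axis[OF x] axis[OF y] add_subgroup_add[OF add_subgroup_axis] unfolding D by auto
    then show "?\<Phi> (x \<otimes>\<^bsub>?D\<^esub> y) = ?\<Phi> x \<otimes>\<^bsub>?B\<^esub> ?\<Phi> y"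
      using \<Phi>[OF x] \<Phi>[OF y] \<Phi>[of "x \<otimes>\<^bsub>?D\<^esub> y"] by (auto simp: fun_eq_iff)
  next
    show "bij_betw ?\<Phi> (carrier ?D) (carrier ?B)"
      unfolding bij_betw_def
    proof (intro conjI inj_onI equalityI subsetI)
      fix x y assume x: "x \<in> carrier ?D" and y: "y \<in> carrier ?D" and eq: "?\<Phi> x = ?\<Phi> y"
      show "x = y"
      proof (rule PiE_ext)
        fix H assume "H \<in> ?S"
        then obtain i where i: "i < n" "H = axis i" by auto
        then have "x H \<in> axis i" "y H \<in> axis i" using axis x y by auto
        moreover have "x H i = y H i" using \<Phi>[OF x, of i] \<Phi>[OF y, of i] i eq by simp
        ultimately show "x H = y H" by (auto simp: axis_def fun_eq_iff) metis
      qed (use x y D in auto)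
    next
      fix g assume "g \<in> ?\<Phi> ` carrier ?D"
      then obtain x where x: "x \<in> carrier ?D" "g = ?\<Phi> x" by blast
      then show "g \<in> carrier ?B" using \<Phi>[OF x(1)] axis[OF x(1)] by (auto simp: box_def axis_def)
    next
      fix g assume g: "g \<in> carrier ?B"
      \<comment> \<open>The preimage of \<open>g\<close> splits it into its coordinates, each placed
        on its own axis.\<close>
      define x where "x = (\<lambda>H\<in>?S. \<lambda>j. if H = axis j then g j else 0)"
      have x: "x \<in> carrier ?D"
        using g unfolding D x_def by (auto simp: box_def axis_eq_iff) (auto simp: axis_def)
      then have "?\<Phi> x = g" using g by (auto simp: \<Phi> fun_eq_iff) (auto simp: x_def box_def)
      with x show "g \<in> ?\<Phi> ` carrier ?D" by blast
    qed
  qed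
  then have "internal_direct_sum ?B ?S"
    using sub unfolding internal_direct_sum_def subgroup_fgroup_iff[OF add_subgroup_box]
    by (auto simp: add_subgroup_axis)
  then show ?thesis
    unfolding completely_decomposable_def using comm_group_fgroup[OF add_subgroup_box] rank_one_axis
    by (auto simp: torsion_free_fgroup add_subgroup_axis intro!: exI[of _ ?S])
qed

text \<open>Vanishing of coordinates and of their sum can be cancelled from a positive multiple. The
  ambient \<open>G\<close> is left general because purity is required both in the box and in the
  edge group.\<close>

lemma pure_subgroup_stage:
  assumes "add_subgroup G" and "\<And>x. x \<in> G \<Longrightarrow> (\<And>i. i \<ge> n \<Longrightarrow> x i = 0) \<Longrightarrow> (\<Sum>i<n. x i) = 0 \<Longrightarrow> x \<in> stage n"
    and "stage n \<subseteq> G"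
  shows "pure_subgroup (stage n) (fgroup G)"
  unfolding pure_subgroup_def subgroup_fgroup_iff[OF assms(1)]
proof (intro conjI allI ballI impI)
  fix m :: nat and g
  assume "m > 0" "g \<in> carrier (fgroup G)" "g [^]\<^bsub>fgroup G\<^esub> m \<in> stage n"
  then have "g \<in> stage n"
    by (intro assms(2)) (auto simp: nat_pow_fgroup stage_def box_def simp flip: sum_distrib_left)
  then show "\<exists>h\<in>stage n. h [^]\<^bsub>fgroup G\<^esub> m = g [^]\<^bsub>fgroup G\<^esub> m" by blast
qed (use assms add_subgroup_stage in auto)

section \<open>The Butler property of the stages and of the edge group\<close>

lemma finite_rank_Butler_stage: "finite_rank_Butler (fgroup (stage n))"
  unfolding finite_rank_Butler_def
proof (intro conjI exI[of _ "fgroup (box n)"] exI[of _ "\<lambda>x. x"])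
  show "(\<lambda>x. x) \<in> mon (fgroup (stage n)) (fgroup (box n))"
    by (auto simp: mon_def hom_def stage_def)
  show "pure_subgroup ((\<lambda>x. x) ` carrier (fgroup (stage n))) (fgroup (box n))"
    using pure_subgroup_stage[OF add_subgroup_box, of n n] by (auto simp: stage_def)
qed (auto simp: torsion_free_fgroup add_subgroup_stage finite_rank_stage finite_rank_box
    completely_decomposable_box)

lemma countable_rank_Butler_edge_group: "countable_rank_Butler (fgroup edge_group)"
  unfolding countable_rank_Butler_def
proof (intro conjI exI[of _ stage] allI)
  show "stage 0 = {\<one>\<^bsub>fgroup edge_group\<^esub>}"
    by (auto simp: stage_def box_def fun_eq_iff)
  fix n
  show "pure_subgroup (stage n) (fgroup edge_group)"
    using add_subgroup_edge_group edge_group_support stage_subset_edge_group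
    by (intro pure_subgroup_stage) auto
  show "stage n \<subseteq> stage (Suc n)" by (simp add: stage_mono)
  show "\<exists>B. subgroup B (fgroup edge_group) \<and>
      finite_rank_Butler (fgroup edge_group\<lparr>carrier := B\<rparr>) \<and>
      stage (Suc n) = stage n <#>\<^bsub>fgroup edge_group\<^esub> B"
  \<comment> \<open>The next stage is itself a Butler group of finite rank containing
    \<open>stage n\<close>, so it can serve as the added subgroup \<open>B\<close>.\<close>
  proof (intro exI[of _ "stage (Suc n)"] conjI)
    show "stage (Suc n) = stage n <#>\<^bsub>fgroup edge_group\<^esub> stage (Suc n)"
    proof (intro equalityI subsetI)
      fix x assume "x \<in> stage (Suc n)"
      then show "x \<in> stage n <#>\<^bsub>fgroup edge_group\<^esub> stage (Suc n)"
        using add_subgroup_zero[OF add_subgroup_stage[of n]]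
        unfolding set_mult_def by (intro UN_I[of 0] UN_I[of x]) auto
    next
      fix x assume "x \<in> stage n <#>\<^bsub>fgroup edge_group\<^esub> stage (Suc n)"
      then show "x \<in> stage (Suc n)"
        using stage_mono[of n "Suc n"] add_subgroup_add[OF add_subgroup_stage[of "Suc n"]]
        by (auto simp: set_mult_def)
    qed
  qed (auto simp: subgroup_fgroup_iff add_subgroup_edge_group add_subgroup_stage
      finite_rank_Butler_stage stage_subset_edge_group[THEN subsetD])
  show "(\<Union>n. stage n) = carrier (fgroup edge_group)" by (simp add: edge_group_def)
qed (simp_all add: torsion_free_fgroup add_subgroup_edge_group countably_infinite_rank_edge_group)

section \<open>Indecomposability\<close>

lemma edge_group_two_support:
  assumes "x \<in> edge_group" "i \<noteq> j" "\<And>l. l \<noteq> i \<Longrightarrow> l \<noteq> j \<Longrightarrow> x l = 0"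
  shows "x = (\<lambda>l. x j * edge i j l)"
proof -
  define n where "n = Suc (max i j)"
  have n: "i < n" "j < n" by (auto simp: n_def)
  have "x \<in> stage n"
    using assms n by (intro edge_group_support) auto
  then have "(\<Sum>l<n. x l) = 0" by (simp add: stage_def)
  moreover have "(\<Sum>l<n. x l) = (\<Sum>l\<in>{i, j}. x l)"
    using assms n by (intro sum.mono_neutral_right) auto
  ultimately have "x i = - x j" using assms by simp
  with assms show ?thesis by (auto simp: edge_def fun_eq_iff)
qed

locale edge_group_decomposition =
  fixes H K :: "(nat \<Rightarrow> rat) set"
  assumes H: "add_subgroup H" "H \<subseteq> edge_group" and K: "add_subgroup K" "K \<subseteq> edge_group"
    and disjoint: "x \<in> H \<Longrightarrow> x \<in> K \<Longrightarrow> x = 0"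
    and decompose: "g \<in> edge_group \<Longrightarrow> \<exists>h\<in>H. \<exists>k\<in>K. g = h + k"
begin

text \<open>Projecting the divisions of the edge by powers of its prime shows that \<open>h\<close>
  is divisible by all these powers within \<open>H\<close>. Away from \<open>i\<close> and
  \<open>j\<close> the prime is not inverted, so the coordinate of \<open>h\<close> must
  vanish.\<close>

lemma edge_component_support:
  assumes "h \<in> H" "k \<in> K" "edge i j = h + k" "l \<noteq> i" "l \<noteq> j"
  shows "h l = 0"
proof -
  let ?p = "edge_prime i j"
  have "\<exists>y\<in>coord l. h l = of_nat ?p ^ m * y" for m
  proof -
    obtain h' k' where h': "h' \<in> H" "k' \<in> K" "(\<lambda>l. edge i j l / of_nat ?p ^ m) = h' + k'"
      using decompose[OF edge_divide_in_edge_group] by blast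
    let ?q = "int (?p ^ m)"
    have p: "of_nat ?p \<noteq> (0::rat)" using prime_edge_prime[of i j] by (auto simp: prime_gt_0_nat)
    \<comment> \<open>the decomposition is unique, so \<open>h = p\<^sup>m h'\<close>\<close>
    define d where "d = h - (\<lambda>l. of_int ?q * h' l)"
    have dk: "d = (\<lambda>l. of_int ?q * k' l) - k"
    proof
      fix l
      have "h l + k l = of_nat ?p ^ m * (h' l + k' l)"
        using fun_cong[OF h'(3), of l] fun_cong[OF assms(3), of l] p by (simp add: field_simps)
      then show "d l = ((\<lambda>l. of_int ?q * k' l) - k) l"
        by (simp add: d_def algebra_simps)
    qed
    have "d \<in> K"
      unfolding dk using h' assms K by (intro add_subgroup_diff add_subgroup_int_mult) auto
    moreover have "d \<in> H"
      unfolding d_def using h' assms H by (intro add_subgroup_diff add_subgroup_int_mult) auto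
    ultimately have "d = 0" by (intro disjoint)
    then have "h l = of_nat ?p ^ m * h' l"
      using fun_cong[of d 0 l] by (simp add: d_def)
    moreover have "h' l \<in> coord l"
      using h'(1) H by (auto simp: edge_group_def stage_def box_def)
    ultimately show ?thesis by blast
  qed
  moreover have "?p \<notin> {p. \<exists>j. p = edge_prime l j \<or> p = edge_prime j l}"
    using assms by (auto simp: edge_prime_eq_iff)
  ultimately show ?thesis
    unfolding coord_def by (intro localized_p_divisible_imp_zero[OF prime_edge_prime])
qed

text \<open>Both components of the edge are rational multiples of it. If both were nonzero, they
  would have a common nonzero integral multiple, lying in both \<open>H\<close> and
  \<open>K\<close>.\<close>

lemma edge_in_summand:
  assumes ij: "i \<noteq> j"
  shows "edge i j \<in> H \<or> edge i j \<in> K"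
proof -
  obtain h k where hk: "h \<in> H" "k \<in> K" "edge i j = h + k"
    using decompose[OF edge_in_edge_group] by blast
  have h: "h = (\<lambda>l. h j * edge i j l)"
    using hk H edge_component_support[OF hk] by (intro edge_group_two_support ij) auto
  obtain u v where "quotient_of (h j) = (u, v)" by fastforce
  then have v: "v > 0" "h j = of_int u / of_int v"
    by (simp_all add: quotient_of_denom_pos quotient_of_div)
  \<comment> \<open>\<open>h\<close> and \<open>k\<close> are the multiples of the edge by \<open>u/v\<close> and \<open>(v-u)/v\<close>\<close>
  define w where "w = (\<lambda>l. of_int (v - u) * h l)"
  have wk: "w = (\<lambda>l. of_int u * k l)"
  proof
    fix l
    have "k l = (1 - h j) * edge i j l"
      using fun_cong[OF hk(3), of l] fun_cong[OF h, of l] by (simp add: algebra_simps)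
    moreover have "of_int (v - u) * h j = of_int u * (1 - h j)"
      using v by (simp add: field_simps)
    ultimately show "w l = of_int u * k l"
      using fun_cong[OF h, of l] by (simp add: w_def)
  qed
  have "w \<in> H" unfolding w_def using hk H by (intro add_subgroup_int_mult)
  moreover have "w \<in> K" unfolding wk using hk K by (intro add_subgroup_int_mult)
  ultimately have "w = 0" by (rule disjoint)
  \<comment> \<open>Since \<open>w j = (v - u) * h j\<close>, either \<open>u = v\<close>, making
    \<open>h j\<close> equal to 1, or \<open>h j = 0\<close>.\<close>
  then have "w j = 0" by simp
  then have "h j = 1 \<or> h j = 0" using v by (auto simp: w_def)
  then show ?thesis
  proof
    assume "h j = 1"
    then have "h = edge i j" using h by simp
    then show ?thesis using hk by simp
  next
    assume "h j = 0"
    then have "h = 0" using h by (simp add: fun_eq_iff)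
    then show ?thesis using hk by simp
  qed
qed

text \<open>First every edge at 0 is forced into \<open>H\<close> by the triangle on 0, 1 and
  \<open>i\<close>. These edges span the group up to positive multiples, and torsion-freeness then
  removes the \<open>K\<close>-component of any element.\<close>

lemma edge_0_1_in_imp_total:
  assumes e: "edge 0 1 \<in> H" shows "H = edge_group"
proof -
  interpret dual_basis edge_group "{1..}" "edge 0" by (rule dual_basis_edge_group)
  have edges: "edge 0 i \<in> H" if "i \<ge> 1" for i
  proof (cases "i = 1")
    case False
    show ?thesis
    proof (rule ccontr)
      assume "edge 0 i \<notin> H"
      then have i: "edge 0 i \<in> K" using edge_in_summand[of 0 i] that by auto
      \<comment> \<open>Whichever summand contains \<open>edge 1 i\<close>, this relation puts
        \<open>edge 0 i\<close> or \<open>edge 0 1\<close> into both summands.\<close>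
      have triangle: "edge 0 i = edge 0 1 + edge 1 i" by (auto simp: edge_def fun_eq_iff)
      consider "edge 1 i \<in> H" | "edge 1 i \<in> K" using edge_in_summand[of 1 i] False by auto
      then show False
      proof cases
        case 1
        then have "edge 0 i \<in> H" using e H triangle by (metis add_subgroup_add)
        then have "edge 0 i = 0" using i by (rule disjoint)
        then show False using that by (simp add: edge_neq_zero)
      next
        case 2
        then have "edge 0 1 \<in> K" using i K triangle by (metis add_subgroup_diff add_diff_cancel_right')
        with e have "edge 0 1 = 0" by (rule disjoint)
        then show False by (simp add: edge_neq_zero)
      qed
    qed
  qed (use e in simp)
  have "g \<in> H" if g: "g \<in> edge_group" for g
  proof -
    obtain h k where hk: "h \<in> H" "k \<in> K" "g = h + k" using decompose[OF g] by blast
    obtain m :: int and F and c :: "nat \<Rightarrow> int" where m: "m > 0" "finite F" "F \<subseteq> {1..}"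
      "(\<lambda>i. of_int m * g i) = (\<Sum>k\<in>F. (\<lambda>i. of_int (c k) * edge 0 k i))"
      using g by (rule multiple_in_span)
    have "(\<lambda>i. of_int m * g i) \<in> H"
      unfolding m(4) using m(3) edges H by (intro add_subgroup_sum add_subgroup_int_mult) auto
    \<comment> \<open>Subtracting \<open>m * h\<close> leaves \<open>m * k\<close>, which therefore
      lies in \<open>H\<close> as well as in \<open>K\<close>.\<close>
    then have "(\<lambda>i. of_int m * g i) - (\<lambda>i. of_int m * h i) \<in> H"
      by (rule add_subgroup_diff[OF H(1) _ add_subgroup_int_mult[OF H(1) hk(1)]])
    moreover have "(\<lambda>i. of_int m * g i) - (\<lambda>i. of_int m * h i) = (\<lambda>i. of_int m * k i)"
      using hk by (simp add: fun_eq_iff algebra_simps)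
    moreover have "(\<lambda>i. of_int m * k i) \<in> K" by (rule add_subgroup_int_mult[OF K(1) hk(2)])
    ultimately have "(\<lambda>i. of_int m * k i) = 0" by (intro disjoint) simp_all
    then have "k = 0" using m(1) by (simp add: fun_eq_iff)
    then show ?thesis using hk by simp
  qed
  then show ?thesis using H by blast
qed

end

lemma edge_group_indecomposable:
  assumes "edge_group_decomposition H K" shows "H = edge_group \<or> K = edge_group"
proof -
  interpret HK: edge_group_decomposition H K by fact
  \<comment> \<open>The hypotheses are symmetric, so the case of \<open>edge 0 1\<close> in
    \<open>K\<close> follows by exchanging the summands.\<close>
  interpret KH: edge_group_decomposition K H
    using HK.H HK.K HK.disjoint HK.decompose by unfold_locales (auto, metis add.commute)
  show ?thesis
    using HK.edge_in_summand[of 0 1] HK.edge_0_1_in_imp_total KH.edge_0_1_in_imp_total by auto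
qed

section \<open>Bassian-finiteness\<close>

lemma Bassian_finite_edge_group: "Bassian_finite (fgroup edge_group)"
  unfolding Bassian_finite_def
proof (intro conjI allI impI)
  show "comm_group (fgroup edge_group)" by (rule comm_group_fgroup[OF add_subgroup_edge_group])
  fix H assume H: "direct_summand H (fgroup edge_group)" "H \<noteq> carrier (fgroup edge_group)"
  then obtain K where K: "subgroup H (fgroup edge_group)" "subgroup K (fgroup edge_group)"
    "H \<inter> K = {0}" "H <#>\<^bsub>fgroup edge_group\<^esub> K = edge_group"
    by (auto simp: direct_summand_def)
  have "edge_group_decomposition H K"
  proof
    show "\<exists>h\<in>H. \<exists>k\<in>K. g = h + k" if "g \<in> edge_group" for g
    proof -
      from that have "g \<in> H <#>\<^bsub>fgroup edge_group\<^esub> K" by (simp only: K(4))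
      then show ?thesis by (auto simp: set_mult_def)
    qed
  qed (use K in \<open>auto simp: subgroup_fgroup_iff add_subgroup_edge_group\<close>)
  \<comment> \<open>A proper summand has the whole group as its complement and is therefore zero. No
    monomorphism into it exists, since the edge group has the nonzero element
    \<open>edge 0 1\<close>.\<close>
  then have "K = edge_group" using H edge_group_indecomposable by auto
  then have H0: "H = {0}" using K by (auto simp: subgroup_fgroup_iff add_subgroup_edge_group)
  have False if f: "f \<in> mon (fgroup edge_group) (fgroup H)" for f
  proof -
    have "f (edge 0 1) = 0" "f 0 = 0"
      using f H0 edge_in_edge_group[of 0 1] add_subgroup_zero[OF add_subgroup_edge_group]
      by (auto simp: mon_def hom_def)
    then have "f (edge 0 1) = f 0" by simp
    moreover have "inj_on f edge_group" using f by (simp add: mon_def)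
    ultimately have "edge 0 1 = 0"
      using edge_in_edge_group add_subgroup_zero[OF add_subgroup_edge_group] by (simp only: inj_on_eq_iff)
    then show False by (simp add: edge_neq_zero)
  qed
  then show "mon (fgroup edge_group) (fgroup edge_group\<lparr>carrier := H\<rparr>) = {}" by auto
qed

section \<open>Failure of complete decomposability\<close>

lemma max_Z_independent_neq_zero:
  assumes "add_subgroup H" "max_Z_independent (fgroup H) X" "x \<in> X"
  shows "x \<noteq> 0"
proof
  assume x: "x = 0"
  \<comment> \<open>If 0 belonged to an independent set, the relation on \<open>{0}\<close> with
    coefficient 1 would be a forbidden one.\<close>
  have "(1::int) = 0"
    using assms(2,3) x unfolding max_Z_independent_def Z_independent_fgroup_iff[OF assms(1)]
    by (elim conjE allE[of _ "{x}"] allE[of _ "\<lambda>_. 1"]) simp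
  then show False by simp
qed

text \<open>\<open>rank_one\<close> asks for just one maximal independent singleton, so each
  candidate \<open>{x}\<close> is refuted by enlarging it with an edge from 0 to a vertex outside
  the support of \<open>x\<close>.\<close>

lemma not_rank_one_edge_group: "\<not> rank_one (fgroup edge_group)"
proof
  assume "rank_one (fgroup edge_group)"
  then obtain x where x: "max_Z_independent (fgroup edge_group) {x}"
    by (auto simp: rank_one_def card_1_singleton_iff)
  then have "x \<noteq> 0" "x \<in> edge_group"
    using max_Z_independent_neq_zero[OF add_subgroup_edge_group x]
    by (auto simp: max_Z_independent_def Z_independent_fgroup_iff add_subgroup_edge_group)
  then obtain l m where l: "x l \<noteq> 0" and m: "x \<in> stage m" by (auto simp: fun_eq_iff edge_group_def)
  \<comment> \<open>\<open>x\<close> vanishes from \<open>m\<close> on; the successor also ensures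
    \<open>n > 0\<close>, since \<open>edge 0 0\<close> is zero.\<close>
  define n where "n = Suc m"
  have n: "n > 0" "x n = 0" using m by (auto simp: n_def stage_def box_def)
  let ?y = "edge 0 n"
  have y: "?y n = 1" using n by (simp add: edge_def)
  have "c z = 0" if F: "F \<subseteq> {x, ?y}" and 0: "\<forall>i. (\<Sum>z\<in>F. of_int (c z) * z i) = 0" and z: "z \<in> F"
    for F z and c :: "_ \<Rightarrow> int"
  proof -
    have fin: "finite F" using F finite_subset by blast
    \<comment> \<open>Coordinate \<open>n\<close> sees only the new edge. Once its coefficient is
      known to vanish, coordinate \<open>l\<close> isolates that of \<open>x\<close>.\<close>
    have cy: "c ?y = 0" if "?y \<in> F"
    proof -
      have "(\<Sum>z\<in>F. of_int (c z) * z n) = (\<Sum>z\<in>{?y}. of_int (c z) * z n)"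
        using F n that fin by (intro sum.mono_neutral_right) auto
      then show ?thesis using 0 y by simp
    qed
    moreover have "c x = 0" if "x \<in> F"
    proof -
      have "(\<Sum>z\<in>F. of_int (c z) * z l) = (\<Sum>z\<in>{x}. of_int (c z) * z l)"
        using F cy that fin by (intro sum.mono_neutral_right) auto
      then show ?thesis using 0 l by simp
    qed
    ultimately show ?thesis using F z by blast
  qed
  then have "Z_independent (fgroup edge_group) {x, ?y}"
    using \<open>x \<in> edge_group\<close> edge_in_edge_group
    by (auto simp: Z_independent_fgroup_iff add_subgroup_edge_group)
  then have "{x, ?y} = {x}" using x unfolding max_Z_independent_def by blast
  then have "?y = x" by blast
  then show False using n y by simp
qed

text \<open>\<open>\<pi>\<close> is the \<open>H\<close>-component of the inverse of the canonical
  isomorphism. Being an additive retraction onto \<open>H\<close>, it will supply a complement of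
  \<open>H\<close> as its kernel.\<close>

lemma internal_direct_sum_projection:
  assumes sum: "internal_direct_sum (fgroup G) S" and G: "add_subgroup G" and H: "H \<in> S"
  obtains \<pi> where "\<And>x. x \<in> G \<Longrightarrow> \<pi> x \<in> H" "\<And>x y. x \<in> G \<Longrightarrow> y \<in> G \<Longrightarrow> \<pi> (x + y) = \<pi> x + \<pi> y"
    "\<And>x. x \<in> H \<Longrightarrow> \<pi> x = x"
proof -
  let ?G = "fgroup G"
  let ?D = "sum_group S (\<lambda>H. ?G\<lparr>carrier := H\<rparr>)"
  let ?\<Phi> = "\<lambda>x. gfinprod ?G x S"
  have iso: "?\<Phi> \<in> iso ?D ?G" and S: "\<And>H. H \<in> S \<Longrightarrow> add_subgroup H \<and> H \<subseteq> G"
    using sum by (auto simp: internal_direct_sum_def subgroup_fgroup_iff[OF G])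
  have grp: "group (?G\<lparr>carrier := H\<rparr>)" if "H \<in> S" for H
    using S[OF that] comm_group_fgroup by (auto simp: comm_group_def)
  then have D: "carrier ?D = {x \<in> \<Pi>\<^sub>E H\<in>S. H. finite {H \<in> S. x H \<noteq> 0}}"
    by (subst carrier_sum_group) auto
  have "group ?D" using grp by (rule sum_group)
  define \<psi> where "\<psi> = inv_into (carrier ?D) ?\<Phi>"
  have \<psi>: "\<psi> \<in> iso ?G ?D"
    unfolding \<psi>_def using \<open>group ?D\<close> iso by (rule group.iso_set_sym)
  show thesis
  proof (rule that[of "\<lambda>x. \<psi> x H"])
    show mem: "\<psi> x H \<in> H" if "x \<in> G" for x
    proof -
      have "\<psi> x \<in> carrier ?D" using \<psi> that by (auto simp: iso_def hom_def)
      then show ?thesis using H unfolding D by auto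
    qed
    show add: "\<psi> (x + y) H = \<psi> x H + \<psi> y H" if "x \<in> G" "y \<in> G" for x y
    proof -
      have "\<psi> (x + y) = \<psi> x \<otimes>\<^bsub>?D\<^esub> \<psi> y" using \<psi> that by (auto simp: iso_def hom_def)
      then show ?thesis using H by simp
    qed
    fix x assume x: "x \<in> H"
    show "\<psi> x H = x"
    \<comment> \<open>For nonzero \<open>x\<close> the preimage is the family concentrated at
      \<open>H\<close>, whose support is exactly \<open>{H}\<close>. For \<open>x = 0\<close> this
      support would be empty, and additivity is used instead.\<close>
    proof (cases "x = 0")
      case True
      have "\<psi> (0 + 0) H = \<psi> 0 H + \<psi> 0 H" using G by (intro add) (auto intro: add_subgroup_zero)
      then show ?thesis using True by simp
    next
      case False
      define s where "s = (\<lambda>K\<in>S. if K = H then x else 0)"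
      have supp: "{K \<in> S. s K \<noteq> 0} = {H}" using H False by (auto simp: s_def)
      have "s \<in> carrier ?D"
        unfolding D using x S supp by (auto simp: s_def add_subgroup_zero)
      moreover have "?\<Phi> s = finprod ?G s {H}"
        by (simp add: gfinprod_def supp)
      then have "?\<Phi> s = x"
        using finprod_fgroup[OF G, of s "{H}"] x H S[OF H] by (auto simp: s_def)
      moreover have "inj_on ?\<Phi> (carrier ?D)" using iso by (auto simp: iso_def bij_betw_def)
      ultimately have "\<psi> x = s" unfolding \<psi>_def by (simp only: inv_into_f_eq)
      then show ?thesis using H by (simp add: s_def)
    qed
  qed
qed

text \<open>Any member \<open>H\<close> of a decomposition into rank-one groups is a direct summand.
  By indecomposability it is the whole group, which does not have rank one, or zero, which does not
  either.\<close>

lemma not_completely_decomposable_edge_group: "\<not> completely_decomposable (fgroup edge_group)"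
proof
  assume "completely_decomposable (fgroup edge_group)"
  then obtain S where S: "internal_direct_sum (fgroup edge_group) S"
    "\<And>H. H \<in> S \<Longrightarrow> rank_one (fgroup H)"
    by (auto simp: completely_decomposable_def)
  \<comment> \<open>An empty decomposition would make the canonical map hit only 0, whereas
    \<open>edge 0 1\<close> is nonzero.\<close>
  have "S \<noteq> {}"
  proof
    assume "S = {}"
    then have "edge_group \<subseteq> {0}"
      using S(1) by (auto simp: internal_direct_sum_def iso_def bij_betw_def gfinprod_def
          finprod_fgroup[OF add_subgroup_edge_group])
    then show False using edge_in_edge_group[of 0 1] edge_neq_zero[of 0 1] by auto
  qed
  then obtain H where H: "H \<in> S" by blast
  then have sub: "add_subgroup H" "H \<subseteq> edge_group"
    using S(1) by (auto simp: internal_direct_sum_def subgroup_fgroup_iff add_subgroup_edge_group)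
  obtain \<pi> where \<pi>: "\<And>x. x \<in> edge_group \<Longrightarrow> \<pi> x \<in> H"
      "\<And>x y. x \<in> edge_group \<Longrightarrow> y \<in> edge_group \<Longrightarrow> \<pi> (x + y) = \<pi> x + \<pi> y"
      "\<And>x. x \<in> H \<Longrightarrow> \<pi> x = x"
    using internal_direct_sum_projection[OF S(1) add_subgroup_edge_group H] by blast
  have diff: "\<pi> (x - y) = \<pi> x - \<pi> y" if "x \<in> edge_group" "y \<in> edge_group" for x y
    using \<pi>(2)[of "x - y" y] that add_subgroup_diff[OF add_subgroup_edge_group] by simp
  \<comment> \<open>The kernel of the projection is the complement: \<open>g\<close> splits as
    \<open>\<pi> g + (g - \<pi> g)\<close>.\<close>
  define K where "K = {x \<in> edge_group. \<pi> x = 0}"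
  have "edge_group_decomposition H K"
  proof
    show "add_subgroup K"
      using \<pi>(3)[of 0] sub diff add_subgroup_zero[OF add_subgroup_edge_group]
        add_subgroup_diff[OF add_subgroup_edge_group]
      by (auto simp: add_subgroup_def K_def)
    show "\<exists>h\<in>H. \<exists>k\<in>K. g = h + k" if "g \<in> edge_group" for g
    proof (intro bexI)
      show "g = \<pi> g + (g - \<pi> g)" by simp
      show "g - \<pi> g \<in> K"
        using that \<pi>(1)[OF that] \<pi>(3) sub diff add_subgroup_diff[OF add_subgroup_edge_group]
        by (auto simp: K_def)
    qed (use \<pi> that in auto)
  qed (use sub \<pi> in \<open>auto simp: K_def\<close>)
  then consider "H = edge_group" | "K = edge_group" using edge_group_indecomposable by blast
  then show False
  proof cases
    case 1
    then show False using S(2)[OF H] not_rank_one_edge_group by simp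
  next
    case 2
    have H0: "x = 0" if "x \<in> H" for x
    proof -
      have "x \<in> K" using 2 sub that by blast
      then show ?thesis using \<pi>(3)[OF that] by (simp add: K_def)
    qed
    obtain X where X: "max_Z_independent (fgroup H) X" "card X = 1"
      using S(2)[OF H] by (auto simp: rank_one_def)
    then obtain x where "x \<in> X" by fastforce
    then have "x \<noteq> 0" "x \<in> H"
      using max_Z_independent_neq_zero[OF sub(1) X(1)] X(1)
      by (auto simp: max_Z_independent_def Z_independent_def)
    then show False using H0 by blast
  qed
qed

theorem mainTheorem6:
  shows "\<exists>G :: (nat \<Rightarrow> rat) monoid.
           countable_rank_Butler G \<and> Bassian_finite G \<and> \<not> completely_decomposable G"
  using countable_rank_Butler_edge_group Bassian_finite_edge_group
    not_completely_decomposable_edge_group by blast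

end
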